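(* Consider the cascaded system $$\dot x_1 = f_1(t,x_1,\theta_1) + g(t,x,\theta)\,x_2,\qquad \dot x_2 = f_2(t,x_2,\theta_2), \qquad (\Sigma)$$ where $x:=(x_1,x_2)\in\mathbb R^{n_1}\times\mathbb R^{n_2}$, $\theta:=(\theta_1,\theta_2)\in\mathbb R^{m_1}\times\mathbb R^{m_2}$ is a constant parameter, $t\in\mathbb R_{\ge 0}$, and $f_1,f_2,g$ are locally Lipschitz in the state and piecewise continuous in time. Let $\Theta_1\subset\mathbb R^{m_1}$ and $\Theta_2\subset\mathbb R^{m_2}$ be sets of parameters. Suppose that the following four assumptions hold. (A1) The system $\dot x_2=f_2(t,x_2,\theta_2)$ is USPAS on $\Theta_2$. (A2) Given any $\Delta_1>\delta_1>0$, there exist a parameter $\theta_1^\star(\delta_1,\Delta_1)\in\Theta_1$, a continuously differentiable function $V_1:\mathbb R_{\ge 0}\times\mathbb R^{n_1}\to\mathbb R_{\ge 0}$ (which may depend on $\delta_1,\Delta_1$), class $\mathcal K_\infty$ functions $\underline\alpha_{\delta_1,\Delta_1}$, $\overline\alpha_{\delta_1,\Delta_1}$, $\alpha_{\delta_1,\Delta_1}$ and a continuous positive nondecreasing function $c_{\delta_1,\Delta_1}$ such that, for all $x_1\in\mathcal H(\delta_1,\Delta_1)$ and all $t\in\mathbb R_{\ge 0}$, $$\underline\alpha_{\delta_1,\Delta_1}(|x_1|_{\delta_1})\le V_1(t,x_1)\le\overline\alpha_{\delta_1,\Delta_1}(|x_1|),$$ $$\frac{\partial V_1}{\partial t}(t,x_1)+\frac{\partial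 V_1}{\partial x_1}(t,x_1)f_1(t,x_1,\theta_1^\star(\delta_1,\Delta_1))\le-\alpha_{\delta_1,\Delta_1}(|x_1|),$$ $$\left|\frac{\partial V_1}{\partial x_1}(t,x_1)\right|\le c_{\delta_1,\Delta_1}(|x_1|),$$ and, for any $\Delta_1>0$, $$\lim_{\delta_1\to0}\underline\alpha_{\delta_1,\Delta_1}^{-1}\circ\overline\alpha_{\delta_1,\Delta_1}(\delta_1)=0.$$ (A3) There exists a nondecreasing function $G:\mathbb R_{\ge0}\to\mathbb R_{\ge0}$ such that, for all $x\in\mathbb R^{n_1}\times\mathbb R^{n_2}$, all $\theta\in\Theta_1\times\Theta_2$ and all $t\in\mathbb R_{\ge0}$, $|g(t,x,\theta)|\le G(|x|)$. (A4) There exists a positive constant $\Delta_0$ such that, for any positive numbers $\delta_1,\Delta_1,\delta_2,\Delta_2$ satisfying $\Delta_1>\max\{\delta_1,\Delta_0\}$ and $\Delta_2>\delta_2$, and for the parameter $\theta_1^\star(\delta_1,\Delta_1)$ of (A2), there exist a parameter $\theta_2^\star\in\mathcal D_{f_2}(\delta_2,\Delta_2)\cap\Theta_2$ and a continuous function $\gamma_{\Delta_1,\Delta_2}:\mathbb R_{>0}\times\mathbb R_{>0}\to\mathbb R_{\ge0}$ (which may also depend on $\delta_1$ and $\delta_2$) such that $$\lim_{\Delta_1,\Delta_2\to\infty}\gamma_{\Delta_1,\Delta_2}(\Delta_1,\Delta_2)=+\infty$$ and the trajectories of $(\Sigma)$ with $\theta=\theta^\star:=(\theta_1^\star(\delta_1,\Delta_1),\theta_2^\star)$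 satisfy, for every initial time $t_0\in\mathbb R_{\ge0}$ and initial state $x_0$, $$|x_0|\le\gamma_{\Delta_1,\Delta_2}(\Delta_1,\Delta_2)\ \Rightarrow\ |x(t,t_0,x_0,\theta^\star)|\le\Delta_1,\quad\forall t\ge t_0.$$ Then the cascaded system $(\Sigma)$ is USPAS on $\Theta_1\times\Theta_2$.
   Context: Notation. $|\cdot|$ is the Euclidean norm of vectors and the induced $L_2$ norm of matrices. $\mathcal B_\delta:=\{x\in\mathbb R^n: |x|\le\delta\}$ is the closed ball; $\mathcal H(\delta,\Delta):=\{x\in\mathbb R^n:\delta\le|x|\le\Delta\}$; $|x|_\delta:=\inf_{z\in\mathcal B_\delta}|x-z|$ (in each case in the appropriate dimension). $x(\cdot,t_0,x_0)$ denotes the solution of a differential equation with initial condition $x(t_0)=x_0$; for a parameterized system, $x(\cdot,t_0,x_0,\theta)$. A continuous $\alpha:\mathbb R_{\ge0}\to\mathbb R_{\ge0}$ is of class $\mathcal K$ if it is strictly increasing and $\alpha(0)=0$; of class $\mathcal K_\infty$ if in addition $\alpha(s)\to\infty$ as $s\to\infty$. A continuous $\sigma:\mathbb R_{\ge0}\to\mathbb R_{\ge0}$ is of class $\mathcal L$ if it is non-increasing and tends to zero as its argument tends to infinity. Stability of balls. Let $\Delta>\delta\ge0$ and consider $\dot x=f(t,x)$. The ball $\mathcal B_\delta$ is Uniformly Stable (US) on $\mathcal B_\Delta$ if there is $\eta\in\mathcal K_\infty$ such that for all $x_0\in\mathcal B_\Delta$, $t_0\ge0$: $|x(t,t_0,x_0)|_\delta\le\eta(|x_0|)$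 for all $t\ge t_0$. It is Uniformly Attractive (UA) on $\mathcal B_\Delta$ if there is $\sigma\in\mathcal L$ such that for all $x_0\in\mathcal B_\Delta$, $t_0\ge0$: $|x(t,t_0,x_0)|_\delta\le\sigma(t-t_0)$ for all $t\ge t_0$. It is Uniformly Asymptotically Stable (UAS) on $\mathcal B_\Delta$ if it is both US and UA on $\mathcal B_\Delta$. USPAS. A parameterized system $\dot x=f(t,x,\theta)$, with $f$ locally Lipschitz in $x$ and piecewise continuous in $t$, $\theta\in\mathbb R^m$ constant, is Uniformly Semiglobally Practically Asymptotically Stable (USPAS) on $\Theta\subset\mathbb R^m$ if, given any $\Delta>\delta>0$, there exists $\theta^\star\in\Theta$ such that $\mathcal B_\delta$ is UAS on $\mathcal B_\Delta$ for $\dot x=f(t,x,\theta^\star)$. $\mathcal D$-set. For $\Delta>\delta\ge0$, $\mathcal D_f(\delta,\Delta):=\{\theta\in\mathbb R^m:\ \mathcal B_\delta\text{ is UAS on }\mathcal B_\Delta\text{ for }\dot x=f(t,x,\theta)\}$.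
   Formalization: In (A4), where γ may depend on δ1 and δ2, the limit γ→+∞ as Δ1,Δ2→∞ is taken uniformly for δ1,δ2 in each bounded interval (0,d]; with a limit only for each fixed δ1,δ2 the claim is false. *)

theory Defs
  imports "HOL-Analysis.Analysis"
begin

text \<open>
  Functions on the nonnegative reals are total functions on \<^typ>\<open>real\<close> whose values at negative
  arguments are irrelevant. Times range over \<open>{0..}\<close>.
\<close>

definition class_K :: "(real \<Rightarrow> real) \<Rightarrow> bool" where
  "class_K \<alpha> \<longleftrightarrow> continuous_on {0..} \<alpha> \<and> strict_mono_on {0..} \<alpha> \<and> \<alpha> 0 = 0"

definition class_Kinf :: "(real \<Rightarrow> real) \<Rightarrow> bool" where
  "class_Kinf \<alpha> \<longleftrightarrow> class_K \<alpha> \<and> filterlim \<alpha> at_top at_top"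

definition class_L :: "(real \<Rightarrow> real) \<Rightarrow> bool" where
  "class_L \<sigma> \<longleftrightarrow> continuous_on {0..} \<sigma> \<and> (\<forall>s\<ge>0. 0 \<le> \<sigma> s)
     \<and> antimono_on {0..} \<sigma> \<and> (\<sigma> \<longlongrightarrow> 0) at_top"

definition annulus :: "real \<Rightarrow> real \<Rightarrow> 'a::real_normed_vector set" where
  "annulus \<delta> \<Delta> = {x. \<delta> \<le> norm x \<and> norm x \<le> \<Delta>}"

definition norm_to_ball :: "real \<Rightarrow> 'a::real_normed_vector \<Rightarrow> real" where
  "norm_to_ball \<delta> x = (INF z\<in>cball 0 \<delta>. norm (x - z))"

text \<open>
  On every bounded interval there are finitely many discontinuities, each of them a finite jump.
\<close>

definition piecewise_continuous :: "(real \<Rightarrow> 'a::topological_space) \<Rightarrow> bool" where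
  "piecewise_continuous h \<longleftrightarrow>
     (\<forall>b\<ge>0. \<exists>S. finite S \<and> continuous_on ({0..b} - S) h)
     \<and> (\<forall>t\<ge>0. \<exists>l. (h \<longlongrightarrow> l) (at_right t))
     \<and> (\<forall>t>0. \<exists>l. (h \<longlongrightarrow> l) (at_left t))"

text \<open>
  For a right-hand side that is locally Lipschitz in the state (locally uniformly in time) and, for
  each fixed state, piecewise continuous in time. The discontinuity times may depend on the state.
\<close>

definition regular_rhs :: "(real \<Rightarrow> 'a::metric_space \<Rightarrow> 'b::metric_space) \<Rightarrow> bool" where
  "regular_rhs f \<longleftrightarrow> local_lipschitz {0..} UNIV f \<and> (\<forall>x. piecewise_continuous (\<lambda>t. f t x))"

text \<open>
  The right-hand side may jump in time, so solutions are understood in the integral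
  (Caratheodory) sense. For a regular right-hand side the integrand is measurable and bounded on
  compact intervals, so that the gauge integral is the Lebesgue integral.
\<close>

definition is_solution ::
    "(real \<Rightarrow> 'a::euclidean_space \<Rightarrow> 'a) \<Rightarrow> real \<Rightarrow> 'a \<Rightarrow> (real \<Rightarrow> 'a) \<Rightarrow> bool" where
  "is_solution f t0 x0 x \<longleftrightarrow> continuous_on {t0..} x \<and> x t0 = x0
     \<and> (\<forall>t\<ge>t0. ((\<lambda>s. f s (x s)) has_integral (x t - x t0)) {t0..t})"

text \<open>
  A property of the solution \<open>x(\<cdot>, t0, x0)\<close> on \<open>{t0..}\<close>: it includes that this solution
  exists for all \<open>t \<ge> t0\<close>. For a regular right-hand side it is unique there.
\<close>

definition solution_satisfies ::
    "(real \<Rightarrow> 'a::euclidean_space \<Rightarrow> 'a) \<Rightarrow> real \<Rightarrow> 'a \<Rightarrow> ((real \<Rightarrow> 'a) \<Rightarrow> bool) \<Rightarrow> bool" where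
  "solution_satisfies f t0 x0 P \<longleftrightarrow>
     (\<exists>x. is_solution f t0 x0 x) \<and> (\<forall>x. is_solution f t0 x0 x \<longrightarrow> P x)"

text \<open>Stability of the ball of radius \<open>\<delta>\<close> on the ball of radius \<open>\<Delta>\<close>.\<close>

definition US :: "(real \<Rightarrow> 'a::euclidean_space \<Rightarrow> 'a) \<Rightarrow> real \<Rightarrow> real \<Rightarrow> bool" where
  "US f \<delta> \<Delta> \<longleftrightarrow> (\<exists>\<eta>. class_Kinf \<eta> \<and> (\<forall>x0\<in>cball 0 \<Delta>. \<forall>t0\<ge>0.
     solution_satisfies f t0 x0 (\<lambda>x. \<forall>t\<ge>t0. norm_to_ball \<delta> (x t) \<le> \<eta> (norm x0))))"

definition UA :: "(real \<Rightarrow> 'a::euclidean_space \<Rightarrow> 'a) \<Rightarrow> real \<Rightarrow> real \<Rightarrow> bool" where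
  "UA f \<delta> \<Delta> \<longleftrightarrow> (\<exists>\<sigma>. class_L \<sigma> \<and> (\<forall>x0\<in>cball 0 \<Delta>. \<forall>t0\<ge>0.
     solution_satisfies f t0 x0 (\<lambda>x. \<forall>t\<ge>t0. norm_to_ball \<delta> (x t) \<le> \<sigma> (t - t0))))"

definition UAS :: "(real \<Rightarrow> 'a::euclidean_space \<Rightarrow> 'a) \<Rightarrow> real \<Rightarrow> real \<Rightarrow> bool" where
  "UAS f \<delta> \<Delta> \<longleftrightarrow> US f \<delta> \<Delta> \<and> UA f \<delta> \<Delta>"

definition USPAS :: "(real \<Rightarrow> 'a::euclidean_space \<Rightarrow> 'p \<Rightarrow> 'a) \<Rightarrow> 'p set \<Rightarrow> bool" where
  "USPAS f \<Theta> \<longleftrightarrow> (\<forall>\<delta> \<Delta>. 0 < \<delta> \<and> \<delta> < \<Delta> \<longrightarrow> (\<exists>\<theta>\<in>\<Theta>. UAS (\<lambda>t x. f t x \<theta>) \<delta> \<Delta>))"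

definition D_set ::
    "(real \<Rightarrow> 'a::euclidean_space \<Rightarrow> 'p \<Rightarrow> 'a) \<Rightarrow> real \<Rightarrow> real \<Rightarrow> 'p set" where
  "D_set f \<delta> \<Delta> = {\<theta>. UAS (\<lambda>t x. f t x \<theta>) \<delta> \<Delta>}"

text \<open>
  The norm of \<^typ>\<open>(real^'n)^'m\<close> is the Frobenius norm; the induced norm is the operator norm.
\<close>

definition mat_norm :: "real^'n^'m \<Rightarrow> real" where
  "mat_norm A = onorm ((*v) A)"

text \<open>
  Functions of \<open>(t, x)\<close> with \<open>t \<ge> 0\<close>; derivatives in \<open>t\<close> at \<open>0\<close> are one-sided. The partial
  derivative in \<open>x\<close> is the linear functional given by the gradient, and its operator norm is the
  Euclidean norm of the gradient.
\<close>

definition C1_nonneg_time :: "(real \<Rightarrow> 'a::euclidean_space \<Rightarrow> real) \<Rightarrow> bool" where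
  "C1_nonneg_time V \<longleftrightarrow> (\<exists>V' :: real \<times> 'a \<Rightarrow> (real \<times> 'a) \<Rightarrow>\<^sub>L real.
     (\<forall>p\<in>{0..} \<times> UNIV.
        ((\<lambda>(s, y). V s y) has_derivative blinfun_apply (V' p)) (at p within {0..} \<times> UNIV))
     \<and> continuous_on ({0..} \<times> UNIV) V')"

definition partial_t :: "(real \<Rightarrow> 'a::euclidean_space \<Rightarrow> real) \<Rightarrow> real \<Rightarrow> 'a \<Rightarrow> real" where
  "partial_t V t x = vector_derivative (\<lambda>s. V s x) (at t within {0..})"

definition partial_x :: "(real \<Rightarrow> 'a::euclidean_space \<Rightarrow> real) \<Rightarrow> real \<Rightarrow> 'a \<Rightarrow> 'a \<Rightarrow> real" where
  "partial_x V t x = frechet_derivative (V t) (at x)"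

text \<open>
  The state space is the product type, whose norm is the Euclidean norm of the stacked vector.
\<close>

definition cascade ::
    "(real \<Rightarrow> real^'n1 \<Rightarrow> 'p1 \<Rightarrow> real^'n1) \<Rightarrow>
     (real \<Rightarrow> real^'n2 \<Rightarrow> 'p2 \<Rightarrow> real^'n2) \<Rightarrow>
     (real \<Rightarrow> (real^'n1) \<times> (real^'n2) \<Rightarrow> 'p1 \<times> 'p2 \<Rightarrow> real^'n2^'n1) \<Rightarrow>
     real \<Rightarrow> (real^'n1) \<times> (real^'n2) \<Rightarrow> 'p1 \<times> 'p2 \<Rightarrow> (real^'n1) \<times> (real^'n2)" where
  "cascade f1 f2 g t x \<theta> =
     (f1 t (fst x) (fst \<theta>) + g t x \<theta> *v snd x, f2 t (snd x) (snd \<theta>))"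

end

theory Submission
  imports Defs
begin

text \<open>
  First \<open>\<Delta>1\<close> and \<open>\<Delta>2\<close> are taken so large that (A4) keeps every solution from \<open>cball 0 \<Delta>\<close> within
  \<open>cball 0 \<Delta>1\<close>, uniformly in small \<open>\<delta>1, \<delta>2\<close>; then \<open>\<delta>1\<close> is taken small by the limit in (A2), and
  finally \<open>\<delta>2\<close> so small that the interconnection term \<open>c(\<Delta>1) G(\<Delta>1) |x2|\<close> is at most half of
  \<open>\<alpha>(\<delta>1)\<close> as soon as \<open>|x2| \<le> 2 \<delta>2\<close>. From then on \<open>V1\<close> decreases at a fixed rate outside \<open>cball 0 \<delta>1\<close>:
  \<open>x1\<close> enters that ball in a uniformly bounded time and afterwards \<open>V1 \<le> \<alpha>_up(\<delta>1)\<close> confines it to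
  \<open>cball 0 (\<delta>/2)\<close>. Small initial states satisfy \<open>|x1| \<le> \<delta>1\<close> and \<open>|x2| \<le> 2 \<delta>2\<close> from the start and never
  leave \<open>cball 0 \<delta>\<close>, so a linear comparison function gives uniform stability.

  Solutions are only differentiable from the right, but everywhere: a right-hand side with one-sided
  limits in time has one-sided limits along a continuous curve. So \<open>V1\<close> is differentiated from the
  right along solutions, and no measure theory is needed.
\<close>

section \<open>Distance to a closed ball\<close>

lemma norm_to_ball_le_norm:
  assumes "0 \<le> \<delta>"
  shows "norm_to_ball \<delta> x \<le> norm x"
proof -
  have "norm_to_ball \<delta> x \<le> norm (x - 0)"
    unfolding norm_to_ball_def
    by (rule cINF_lower) (use assms in \<open>auto intro!: bdd_belowI2[where m=0]\<close>)
  then show ?thesis by simp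
qed

lemma norm_to_ball_eq_0:
  assumes "norm x \<le> \<delta>"
  shows "norm_to_ball \<delta> x = 0"
proof (rule antisym)
  have "norm_to_ball \<delta> x \<le> norm (x - x)"
    unfolding norm_to_ball_def
    by (rule cINF_lower) (use assms in \<open>auto intro!: bdd_belowI2[where m=0]\<close>)
  then show "norm_to_ball \<delta> x \<le> 0" by simp
  have "cball 0 \<delta> \<noteq> ({} :: 'a set)"
    using order_trans[OF norm_ge_zero assms] by simp
  then show "0 \<le> norm_to_ball \<delta> x"
    unfolding norm_to_ball_def by (intro cINF_greatest) auto
qed

lemma norm_le_norm_to_ball:
  assumes "0 \<le> \<delta>"
  shows "norm x \<le> \<delta> + norm_to_ball \<delta> x"
proof -
  have "norm x - \<delta> \<le> norm_to_ball \<delta> x"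
    unfolding norm_to_ball_def
  proof (rule cINF_greatest)
    show "cball 0 \<delta> \<noteq> ({} :: 'a set)" using assms by auto
    fix z :: 'a assume "z \<in> cball 0 \<delta>"
    then show "norm x - \<delta> \<le> norm (x - z)"
      using norm_triangle_ineq2[of x z] by auto
  qed
  then show ?thesis by simp
qed

section \<open>Right derivatives and right limits\<close>

text \<open>A mean value inequality from right derivatives alone. If it failed, a slightly tilted
  copy \<open>h\<close> of \<open>W\<close> would start at 0 and end positive, yet have a negative
  right derivative everywhere. At the last time with \<open>h\<close> nonpositive, \<open>h\<close>
  would have to drop just afterwards, contradicting the choice of that time.\<close>

lemma right_derivative_decrease:
  fixes W :: "real \<Rightarrow> real"
  assumes "a \<le> b" and cont: "continuous_on {a..b} W"
    and deriv: "\<And>t. a \<le> t \<Longrightarrow> t < b \<Longrightarrow>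
      \<exists>D \<le> - k. (W has_real_derivative D) (at_right t)"
  shows "W b \<le> W a - k * (b - a)"
proof (rule ccontr)
  assume "\<not> ?thesis"
  then have "a \<noteq> b" and gap: "W b - W a + k * (b - a) > 0" by auto
  with \<open>a \<le> b\<close> have ab: "a < b" by simp
  \<comment> \<open>Half of the average excess slope: then \<open>h b\<close> is half of the gap,
    hence positive, while the right derivative of \<open>h\<close> is at most
    \<open>- e\<close>.\<close>
  define e where "e = (W b - W a + k * (b - a)) / (2 * (b - a))"
  have e: "0 < e" using gap ab by (simp add: e_def)
  define h where "h t = W t - W a + (k - e) * (t - a)" for t
  have e2: "e * (b - a) = (W b - W a + k * (b - a)) / 2"
    using ab by (simp add: e_def field_simps)
  have hb: "h b > 0" using gap e2 by (simp add: h_def left_diff_distrib)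
  have ch: "continuous_on {a..b} h" unfolding h_def by (intro continuous_intros cont)
  define S where "S = {t \<in> {a..b}. h t \<le> 0}"
  have S0: "a \<in> S" using ab by (simp add: S_def h_def)
  have "closed S" unfolding S_def
    by (intro continuous_on_closed_Collect_le ch continuous_intros)
  moreover have bdd: "bdd_above S" unfolding S_def by (auto intro!: bdd_aboveI)
  ultimately have Sup: "Sup S \<in> S"
    using S0 closed_contains_Sup by blast
  define s where "s = Sup S"
  have s: "a \<le> s" "s < b" "h s \<le> 0"
    using Sup hb unfolding s_def[symmetric] unfolding S_def by (auto simp: less_le)
  obtain D where D: "D \<le> - k" "(W has_real_derivative D) (at_right s)"
    using deriv[OF s(1,2)] by blast
  have "(h has_real_derivative (D + (k - e))) (at_right s)"
    unfolding h_def using D(2) by (auto intro!: derivative_eq_intros)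
  then obtain d where d: "d > 0" "\<And>y. y > 0 \<Longrightarrow> y < d \<Longrightarrow> h (s + y) < h s"
    using has_real_derivative_neg_dec_right[of h "D + (k - e)" s "{s<..}"] D(1) e by auto
  \<comment> \<open>Short enough for the drop of \<open>h\<close> to hold and for
    \<open>s + y\<close> to stay in the interval.\<close>
  define y where "y = min (d / 2) (b - s)"
  have y: "y > 0" "y < d" "s + y \<le> b" using d(1) s(2) by (auto simp: y_def)
  have "s + y \<in> S" using d(2)[OF y(1,2)] s y by (auto simp: S_def)
  then have "s + y \<le> s" unfolding s_def using bdd by (rule cSup_upper)
  then show False using y by simp
qed

text \<open>Piecewise continuity concerns a frozen state, whereas a solution moves. The Lipschitz
  constant is uniform in time near \<open>t\<close>, so the difference between frozen and moving
  state vanishes in the limit. That both limits are the same \<open>l\<close> lets inequalities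
  known at a frozen state pass to the solution.\<close>

lemma regular_rhs_right_limit:
  fixes f :: "real \<Rightarrow> 'a::metric_space \<Rightarrow> 'b::real_normed_vector"
  assumes f: "regular_rhs f" and "0 \<le> t"
    and x: "(x \<longlongrightarrow> x t) (at_right t)"
  obtains l where "((\<lambda>s. f s (x t)) \<longlongrightarrow> l) (at_right t)" "((\<lambda>s. f s (x s)) \<longlongrightarrow> l) (at_right t)"
proof -
  obtain l where l: "((\<lambda>s. f s (x t)) \<longlongrightarrow> l) (at_right t)"
    using f \<open>0 \<le> t\<close> unfolding regular_rhs_def piecewise_continuous_def by blast
  have "local_lipschitz {0..} UNIV f" using f by (simp add: regular_rhs_def)
  then obtain u L where u: "0 < u"
    and L: "\<And>s. s \<in> cball t u \<inter> {0..} \<Longrightarrow> L-lipschitz_on (cball (x t) u \<inter> UNIV) (f s)"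
    using \<open>0 \<le> t\<close> by (elim local_lipschitzE) auto
  have near_t: "\<forall>\<^sub>F s in at_right t. s \<in> {t<..<t + u}"
    using u eventually_at_right_real[of t "t + u"] by simp
  have near_x: "\<forall>\<^sub>F s in at_right t. dist (x s) (x t) < u"
    using x u by (rule tendstoD)
  have "\<forall>\<^sub>F s in at_right t. norm (f s (x s) - f s (x t)) \<le> dist (x s) (x t) * L"
    using near_t near_x
  proof eventually_elim
    case (elim s)
    have "L-lipschitz_on (cball (x t) u \<inter> UNIV) (f s)"
      using elim \<open>0 \<le> t\<close> by (intro L) (auto simp: dist_real_def)
    from lipschitz_onD[OF this, of "x s" "x t"] show ?case
      using elim u by (auto simp: dist_norm[of "f _ _"] dist_commute mult.commute)
  qed
  moreover have "((\<lambda>s. dist (x s) (x t)) \<longlongrightarrow> 0) (at_right t)"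
    by (rule tendsto_dist_iff[THEN iffD1, OF x])
  then have "((\<lambda>s. dist (x s) (x t) * L) \<longlongrightarrow> 0) (at_right t)"
    by (rule tendsto_mult_left_zero)
  ultimately have "((\<lambda>s. f s (x s) - f s (x t)) \<longlongrightarrow> 0) (at_right t)"
    by (rule Lim_null_comparison)
  from tendsto_add[OF l this] have "((\<lambda>s. f s (x s)) \<longlongrightarrow> l) (at_right t)" by simp
  with l show ?thesis by (rule that)
qed

text \<open>The one-sided fundamental theorem of calculus. Only the values of \<open>F\<close> just
  after \<open>t\<close> matter, so the derivative is the right limit \<open>l\<close>, which may
  differ from \<open>F t\<close>.\<close>

lemma has_integral_right_derivative:
  fixes x F :: "real \<Rightarrow> 'a::euclidean_space"
  assumes int: "\<And>t. t0 \<le> t \<Longrightarrow> (F has_integral (x t - x t0)) {t0..t}"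
    and "t0 \<le> t" and l: "(F \<longlongrightarrow> l) (at_right t)"
  shows "(x has_vector_derivative l) (at_right t)"
proof -
  have sub: "(F has_integral (x s - x t)) {t..s}" if "t \<le> s" for s
  proof -
    have "F integrable_on {t0..s}" using int[of s] that \<open>t0 \<le> t\<close> by auto
    then have i: "F integrable_on {t..s}"
      by (rule integrable_subinterval_real) (use \<open>t0 \<le> t\<close> in auto)
    from has_integral_combine[OF \<open>t0 \<le> t\<close> that int[OF \<open>t0 \<le> t\<close>] integrable_integral[OF i]]
    have "x t - x t0 + integral {t..s} F = x s - x t0"
      by (rule has_integral_unique) (use int[of s] that \<open>t0 \<le> t\<close> in simp)
    then have "integral {t..s} F = x s - x t" by (simp add: algebra_simps)
    then show ?thesis using i by (metis integrable_integral)
  qed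
  show ?thesis
    unfolding has_vector_derivative_def has_derivative_within_alt2
  proof (intro conjI allI impI)
    show "bounded_linear (\<lambda>h. h *\<^sub>R l)" by (rule bounded_linear_scaleR_left)
    fix e :: real assume e: "0 < e"
    have "\<forall>\<^sub>F s in at_right t. dist (F s) l < e" using l e by (rule tendstoD)
    then obtain b where b: "t < b" "\<And>s. t < s \<Longrightarrow> s < b \<Longrightarrow> dist (F s) l < e"
      unfolding eventually_at_right_field by blast
    have "\<forall>\<^sub>F s in at_right t. s \<in> {t<..<b}"
      using b eventually_at_right_real[of t b] by simp
    then show "\<forall>\<^sub>F s in at_right t. norm (x s - x t - (s - t) *\<^sub>R l) \<le> e * norm (s - t)"
    proof eventually_elim
      case (elim s)
      have "((\<lambda>r. F r - l) has_integral (x s - x t - (s - t) *\<^sub>R l)) (cbox t s)"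
        using has_integral_diff[OF sub[of s] has_integral_const_real[of l t s]] elim by simp
      \<comment> \<open>Closeness to \<open>l\<close> is known only strictly after \<open>t\<close>,
        so the point \<open>t\<close> itself is removed from the interval.\<close>
      from has_integral_bound_spike_finite[OF _ _ this, of e "{t}"]
      show ?case using elim e b by (auto simp: dist_norm less_imp_le)
    qed
  qed
qed

section \<open>Derivatives of a C1 function and the operator norm of a matrix\<close>

text \<open>The partial derivatives are defined by choice operators. Restricting the joint
  derivative to the time axis and to the state space identifies them as its values, which makes the
  continuity of \<open>V'\<close> and the chain rule available.\<close>

lemma C1_nonneg_time_derivative:
  assumes "C1_nonneg_time V"
  obtains V' where
    "\<And>t x. 0 \<le> t \<Longrightarrow>
      ((\<lambda>(s, y). V s y) has_derivative blinfun_apply (V' (t, x))) (at (t, x) within {0..} \<times> UNIV)"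
    "continuous_on ({0..} \<times> UNIV) V'"
    "\<And>t x. 0 \<le> t \<Longrightarrow> partial_t V t x = blinfun_apply (V' (t, x)) (1, 0)"
    "\<And>t x. 0 \<le> t \<Longrightarrow> partial_x V t x = (\<lambda>h. blinfun_apply (V' (t, x)) (0, h))"
proof -
  obtain V' where V': "\<And>t x. 0 \<le> t \<Longrightarrow>
      ((\<lambda>(s, y). V s y) has_derivative blinfun_apply (V' (t, x))) (at (t, x) within {0..} \<times> UNIV)"
    and c: "continuous_on ({0..} \<times> UNIV) V'"
    using assms unfolding C1_nonneg_time_def by auto
  have "partial_t V t x = blinfun_apply (V' (t, x)) (1, 0)" if t: "0 \<le> t" for t x
  proof -
    have "((\<lambda>s. (s, x)) has_derivative (\<lambda>h. (h, 0))) (at t within {0..})"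
      by (auto intro!: derivative_eq_intros)
    from has_derivative_in_compose[OF this has_derivative_subset[OF V'[OF t, of x]]]
    have "((\<lambda>s. V s x) has_derivative (\<lambda>h. blinfun_apply (V' (t, x)) (h, 0))) (at t within {0..})"
      by auto
    then have "((\<lambda>s. V s x) has_derivative (\<lambda>h. h *\<^sub>R blinfun_apply (V' (t, x)) (1, 0))) (at t within {0..})"
    proof (rule has_derivative_eq_rhs, intro ext)
      fix h show "blinfun_apply (V' (t, x)) (h, 0) = h *\<^sub>R blinfun_apply (V' (t, x)) (1, 0)"
        using blinfun.scaleR_right[of "V' (t, x)" h "(1, 0)"] by simp
    qed
    then have "((\<lambda>s. V s x) has_vector_derivative blinfun_apply (V' (t, x)) (1, 0)) (at t within {0..})"
      unfolding has_vector_derivative_def .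
    \<comment> \<open>Uniqueness of the derivative needs a nontrivial filter; at time 0 only later
      times are available.\<close>
    moreover have "at_right t \<le> at t within {0..}"
      using t by (intro at_le) auto
    then have "at t within {0..} \<noteq> bot"
      using trivial_limit_at_right_real[of t] by (metis bot.extremum_uniqueI)
    ultimately show ?thesis
      unfolding partial_t_def by (intro vector_derivative_within)
  qed
  moreover have "partial_x V t x = (\<lambda>h. blinfun_apply (V' (t, x)) (0, h))" if t: "0 \<le> t" for t x
  proof -
    have "((\<lambda>y. (t, y)) has_derivative (\<lambda>h. (0, h))) (at x)"
      by (auto intro!: derivative_eq_intros)
    from has_derivative_in_compose[OF this has_derivative_subset[OF V'[OF t, of x]]]
    have "((\<lambda>y. V t y) has_derivative (\<lambda>h. blinfun_apply (V' (t, x)) (0, h))) (at x)"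
      using t by auto
    then show ?thesis unfolding partial_x_def by (rule frechet_derivative_at[symmetric])
  qed
  ultimately show ?thesis using that V' c by blast
qed

lemma norm_matrix_vector_mult_le: "norm (A *v v) \<le> mat_norm A * norm v"
  unfolding mat_norm_def by (intro onorm matrix_vector_mul_bounded_linear)

section \<open>Comparison functions of class K-infinity\<close>

lemma class_Kinf_zero: "class_Kinf \<alpha> \<Longrightarrow> \<alpha> 0 = 0"
  by (simp add: class_Kinf_def class_K_def)

lemma class_Kinf_mono: "class_Kinf \<alpha> \<Longrightarrow> 0 \<le> s \<Longrightarrow> s \<le> t \<Longrightarrow> \<alpha> s \<le> \<alpha> t"
  by (auto simp: class_Kinf_def class_K_def intro: strict_mono_on_leD)

lemma class_Kinf_pos: "class_Kinf \<alpha> \<Longrightarrow> 0 < s \<Longrightarrow> 0 < \<alpha> s"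
  using strict_mono_onD[of "{0..}" \<alpha> 0 s] by (auto simp: class_Kinf_def class_K_def)

text \<open>\<open>inv_into\<close> is a true inverse only on the range of \<open>\<alpha>\<close>.
  The intermediate value theorem and unboundedness put every nonnegative \<open>s\<close> in that
  range, and strict monotonicity does the rest.\<close>

lemma le_inv_into_class_Kinf:
  assumes "class_Kinf \<alpha>" "0 \<le> s" "0 \<le> w" "\<alpha> w \<le> s"
  shows "w \<le> inv_into {0..} \<alpha> s"
proof -
  have c: "continuous_on {0..} \<alpha>" and m: "strict_mono_on {0..} \<alpha>" and z: "\<alpha> 0 = 0"
    and lim: "filterlim \<alpha> at_top at_top"
    using assms(1) by (auto simp: class_Kinf_def class_K_def)
  obtain b where b: "0 \<le> b" "s \<le> \<alpha> b"
    using eventually_happens'[OF _ eventually_conj[OF eventually_ge_at_top[of 0] 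
          filterlim_at_top[THEN iffD1, OF lim, rule_format, of s]]] by auto
  have "\<exists>y. 0 \<le> y \<and> y \<le> b \<and> \<alpha> y = s"
    using b z assms(2) by (intro IVT') (auto intro: continuous_on_subset[OF c])
  then have "s \<in> \<alpha> ` {0..}" by auto
  from f_inv_into_f[OF this] inv_into_into[OF this]
  have "\<alpha> (inv_into {0..} \<alpha> s) = s" "0 \<le> inv_into {0..} \<alpha> s" by auto
  then show ?thesis
    using assms strict_mono_on_leD[OF m] strict_mono_onD[OF m, of "inv_into {0..} \<alpha> s" w]
    by (auto simp: not_less[symmetric])
qed

section \<open>Solutions of the cascade and the Lyapunov function along them\<close>

text \<open>The cascade is triangular, so projecting its integral equation leaves that of the
  driving system. Stability estimates for \<open>f2\<close> thereby apply to the second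
  component.\<close>

lemma is_solution_cascade_snd:
  assumes "is_solution (\<lambda>t x. cascade f1 f2 g t x \<theta>) t0 x0 x"
  shows "is_solution (\<lambda>t y. f2 t y (snd \<theta>)) t0 (snd x0) (\<lambda>t. snd (x t))"
proof -
  have "((\<lambda>s. f2 s (snd (x s)) (snd \<theta>)) has_integral (snd (x t) - snd (x t0))) {t0..t}"
    if "t0 \<le> t" for t
  proof -
    have "((\<lambda>s. cascade f1 f2 g s (x s) \<theta>) has_integral (x t - x t0)) {t0..t}"
      using assms that unfolding is_solution_def by blast
    from has_integral_linear[OF this bounded_linear_snd] show ?thesis
      by (simp add: cascade_def o_def)
  qed
  then show ?thesis
    using assms by (auto simp: is_solution_def intro: continuous_on_snd)
qed

lemma lyapunov_right_derivative:
  fixes f :: "real \<Rightarrow> real^'n1 \<Rightarrow> real^'n1"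
    and g :: "real \<Rightarrow> (real^'n1) \<times> (real^'n2) \<Rightarrow> real^'n2^'n1"
    and x :: "real \<Rightarrow> (real^'n1) \<times> (real^'n2)"
  assumes V: "C1_nonneg_time V" and f: "regular_rhs f" and g: "regular_rhs g"
    and t: "0 \<le> t0" "t0 \<le> t" and x: "continuous_on {t0..} x"
    and int: "\<And>t. t0 \<le> t \<Longrightarrow>
      ((\<lambda>s. f s (fst (x s)) + g s (x s) *v snd (x s)) has_integral (fst (x t) - fst (x t0))) {t0..t}"
    and decrease: "\<And>s. 0 \<le> s \<Longrightarrow>
      partial_t V s (fst (x t)) + partial_x V s (fst (x t)) (f s (fst (x t))) \<le> - a"
    and gradient: "onorm (partial_x V t (fst (x t))) \<le> C" and "0 \<le> C"
    and g_bound: "\<And>s. 0 \<le> s \<Longrightarrow> mat_norm (g s (x t)) \<le> B"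
  shows "\<exists>D \<le> - a + C * B * norm (snd (x t)).
    ((\<lambda>s. V s (fst (x s))) has_real_derivative D) (at_right t)"
proof -
  obtain V' where V': "\<And>t x. 0 \<le> t \<Longrightarrow>
      ((\<lambda>(s, y). V s y) has_derivative blinfun_apply (V' (t, x))) (at (t, x) within {0..} \<times> UNIV)"
    and V'_cont: "continuous_on ({0..} \<times> UNIV) V'"
    and V'_t: "\<And>t x. 0 \<le> t \<Longrightarrow> partial_t V t x = blinfun_apply (V' (t, x)) (1, 0)"
    and V'_x: "\<And>t x. 0 \<le> t \<Longrightarrow> partial_x V t x = (\<lambda>h. blinfun_apply (V' (t, x)) (0, h))"
    using C1_nonneg_time_derivative[OF V] by blast
  have t0: "0 \<le> t" using t by simp
  have lim_x: "(x \<longlongrightarrow> x t) (at_right t)"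
  proof -
    have "(x \<longlongrightarrow> x t) (at t within {t0..})"
      using x t by (simp add: continuous_on_def)
    then show ?thesis by (rule tendsto_within_subset) (use t in auto)
  qed
  have ev: "\<forall>\<^sub>F s in at_right t. 0 \<le> s"
    using eventually_at_right_less[of t] by eventually_elim (use t0 in simp)
  obtain l where l: "((\<lambda>s. f s (fst (x t))) \<longlongrightarrow> l) (at_right t)"
      "((\<lambda>s. f s (fst (x s))) \<longlongrightarrow> l) (at_right t)"
    by (rule regular_rhs_right_limit[OF f t0, of "\<lambda>s. fst (x s)"]) (auto intro: tendsto_fst lim_x)
  obtain m where m: "((\<lambda>s. g s (x t)) \<longlongrightarrow> m) (at_right t)"
      "((\<lambda>s. g s (x s)) \<longlongrightarrow> m) (at_right t)"
    by (rule regular_rhs_right_limit[OF g t0 lim_x])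
  define D where "D = l + m *v snd (x t)"
  have tendsto_mv: "((\<lambda>s. A s *v v s) \<longlongrightarrow> L *v w) (at_right t)"
    if "(A \<longlongrightarrow> L) (at_right t)" "(v \<longlongrightarrow> w) (at_right t)"
    for A :: "real \<Rightarrow> real^'n2^'n1" and v L w
    unfolding matrix_vector_mult_def using that
    by (intro tendsto_vec_lambda tendsto_sum tendsto_mult tendsto_vec_nth)
  have "((\<lambda>s. f s (fst (x s)) + g s (x s) *v snd (x s)) \<longlongrightarrow> D) (at_right t)"
    unfolding D_def by (intro tendsto_add l tendsto_mv m tendsto_snd lim_x)
  with int t(2) have "((\<lambda>s. fst (x s)) has_vector_derivative D) (at_right t)"
    by (rule has_integral_right_derivative)
  then have "((\<lambda>s. (s, fst (x s))) has_derivative (\<lambda>h. (h, h *\<^sub>R D))) (at_right t)"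
    unfolding has_vector_derivative_def by (intro has_derivative_Pair has_derivative_ident)
  from has_derivative_in_compose[OF this has_derivative_subset[OF V'[OF t0]]]
  have "((\<lambda>s. V s (fst (x s))) has_derivative (\<lambda>h. blinfun_apply (V' (t, fst (x t))) (h, h *\<^sub>R D)))
      (at_right t)"
    using t0 by (auto simp: image_subset_iff)
  then have "((\<lambda>s. V s (fst (x s))) has_derivative (\<lambda>h. blinfun_apply (V' (t, fst (x t))) (1, D) * h))
      (at_right t)"
  proof (rule has_derivative_eq_rhs, intro ext)
    fix h show "blinfun_apply (V' (t, fst (x t))) (h, h *\<^sub>R D) = blinfun_apply (V' (t, fst (x t))) (1, D) * h"
      using blinfun.scaleR_right[of "V' (t, fst (x t))" h "(1, D)"] by simp
  qed
  then have deriv: "((\<lambda>s. V s (fst (x s))) has_real_derivative blinfun_apply (V' (t, fst (x t))) (1, D))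
      (at_right t)"
    by (simp add: has_field_derivative_def)
  have "((\<lambda>s. V' (s, fst (x t))) \<longlongrightarrow> V' (t, fst (x t))) (at_right t)"
    by (rule continuous_on_tendsto_compose[OF V'_cont])
      (use t0 ev in \<open>auto intro!: tendsto_Pair tendsto_ident_at\<close>)
  from blinfun.tendsto[OF this tendsto_Pair[OF tendsto_const l(1)]]
  have "((\<lambda>s. blinfun_apply (V' (s, fst (x t))) (1, f s (fst (x t)))) \<longlongrightarrow>
      blinfun_apply (V' (t, fst (x t))) (1, l)) (at_right t)" .
  moreover have "\<forall>\<^sub>F s in at_right t. blinfun_apply (V' (s, fst (x t))) (1, f s (fst (x t))) \<le> - a"
    using ev
  proof eventually_elim
    case (elim s)
    then show ?case
      using decrease[of s] blinfun.add_right[of "V' (s, fst (x t))" "(1, 0)" "(0, f s (fst (x t)))"]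
      by (simp add: V'_t V'_x)
  qed
  ultimately have main: "blinfun_apply (V' (t, fst (x t))) (1, l) \<le> - a"
    by (rule tendsto_upperbound) simp
  have "((\<lambda>s. norm (g s (x t) *v snd (x t))) \<longlongrightarrow> norm (m *v snd (x t))) (at_right t)"
    by (intro tendsto_norm tendsto_mv m tendsto_const)
  moreover have "\<forall>\<^sub>F s in at_right t. norm (g s (x t) *v snd (x t)) \<le> B * norm (snd (x t))"
    using ev
  proof eventually_elim
    case (elim s)
    then show ?case
      using norm_matrix_vector_mult_le[of "g s (x t)" "snd (x t)"]
        mult_right_mono[OF g_bound[of s], of "norm (snd (x t))"] by simp
  qed
  ultimately have m_bound: "norm (m *v snd (x t)) \<le> B * norm (snd (x t))"
    by (rule tendsto_upperbound) simp
  have bl: "bounded_linear (partial_x V t (fst (x t)))"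
    unfolding V'_x[OF t0] by (intro bounded_linear_intros)
  \<comment> \<open>The interconnection contributes at most gradient bound times coupling bound
    times the norm of the second component.\<close>
  have "blinfun_apply (V' (t, fst (x t))) (0, m *v snd (x t)) \<le> C * norm (m *v snd (x t))"
    using onorm[OF bl, of "m *v snd (x t)"] mult_right_mono[OF gradient, of "norm (m *v snd (x t))"]
    by (simp add: V'_x[OF t0])
  also have "\<dots> \<le> C * B * norm (snd (x t))"
    using mult_left_mono[OF m_bound \<open>0 \<le> C\<close>] by (simp add: mult.assoc)
  finally have "blinfun_apply (V' (t, fst (x t))) (1, D) \<le> - a + C * B * norm (snd (x t))"
    using main blinfun.add_right[of "V' (t, fst (x t))" "(1, l)" "(0, m *v snd (x t))"]
    by (simp add: D_def)
  with deriv show ?thesis by blast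
qed

text \<open>Consider the last time before \<open>t\<close> at which \<open>y\<close> lies in the
  ball of radius \<open>\<delta>\<close>. There \<open>y\<close> is on the sphere, so
  \<open>W\<close> is at most \<open>M\<close>, and from then on \<open>y\<close> stays where
  \<open>W\<close> cannot increase.\<close>

lemma lyapunov_trap:
  fixes y :: "real \<Rightarrow> 'a::real_normed_vector" and W :: "real \<Rightarrow> real"
  assumes "s \<le> t" and y: "continuous_on {s..t} y" and W: "continuous_on {s..t} W"
    and start: "norm (y s) \<le> \<delta>"
    and decrease: "\<And>r. s \<le> r \<Longrightarrow> r < t \<Longrightarrow> \<delta> \<le> norm (y r) \<Longrightarrow>
      \<exists>D \<le> 0. (W has_real_derivative D) (at_right r)"
    and boundary: "\<And>r. s \<le> r \<Longrightarrow> r \<le> t \<Longrightarrow> norm (y r) = \<delta> \<Longrightarrow> W r \<le> M"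
    and outside: "\<delta> < norm (y t)"
  shows "W t \<le> M"
proof -
  define S where "S = {r \<in> {s..t}. norm (y r) \<le> \<delta>}"
  have "closed S" unfolding S_def
    by (intro continuous_on_closed_Collect_le continuous_intros y)
  moreover have bdd: "bdd_above S" unfolding S_def by (auto intro!: bdd_aboveI)
  moreover have "s \<in> S" using start \<open>s \<le> t\<close> by (simp add: S_def)
  ultimately have Sup: "Sup S \<in> S"
    using closed_contains_Sup by blast
  define r where "r = Sup S"
  have r: "s \<le> r" "r \<le> t" "norm (y r) \<le> \<delta>"
    using Sup unfolding r_def[symmetric] unfolding S_def by auto
  have last: "q \<le> r" if "q \<in> S" for q
    unfolding r_def using that bdd by (rule cSup_upper)
  \<comment> \<open>A crossing of the sphere at or after \<open>r\<close> belongs to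
    \<open>S\<close>, so it can only be \<open>r\<close> itself; hence \<open>y r\<close> lies on
    the sphere.\<close>
  have "\<exists>q. r \<le> q \<and> q \<le> t \<and> norm (y q) = \<delta>"
    using r outside
    by (intro IVT' continuous_on_norm continuous_on_subset[OF y]) auto
  then obtain q where q: "r \<le> q" "q \<le> t" "norm (y q) = \<delta>" by blast
  then have "q = r" using last[of q] r by (auto simp: S_def)
  then have "W r \<le> M" using boundary q r by blast
  have beyond: "\<delta> \<le> norm (y p)" if "r \<le> p" "p < t" for p
  proof (rule ccontr)
    assume *: "\<not> ?thesis"
    then have "p \<in> S" using r that by (simp add: S_def)
    then have "p = r" using last that by force
    then show False using * q(3) \<open>q = r\<close> by simp
  qed
  have "W t \<le> W r - 0 * (t - r)"
  proof (rule right_derivative_decrease[OF r(2)])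
    show "continuous_on {r..t} W" using W by (rule continuous_on_subset) (use r in auto)
    fix q assume "r \<le> q" "q < t"
    then show "\<exists>D \<le> - 0. (W has_real_derivative D) (at_right q)"
      using decrease[of q] beyond[of q] r by simp
  qed
  then show ?thesis using \<open>W r \<le> M\<close> by simp
qed

section \<open>Uniform asymptotic stability for fixed radii and parameters\<close>

text \<open>The analytic core, with all radii and parameters frozen. The limits in the assumptions
  of the theorem enter only through \<open>bounded\<close> and the inequalities
  \<open>small\<close>, so the order in which the radii are chosen is a separate matter.\<close>

lemma UAS_cascade:
  fixes f1 :: "real \<Rightarrow> real^'n1 \<Rightarrow> real^'n1"
    and f2 :: "real \<Rightarrow> real^'n2 \<Rightarrow> real^'n2"
    and g :: "real \<Rightarrow> (real^'n1) \<times> (real^'n2) \<Rightarrow> real^'n2^'n1"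
  defines "F \<equiv> \<lambda>t x. (f1 t (fst x) + g t x *v snd x, f2 t (snd x))"
  assumes f1: "regular_rhs f1" and g: "regular_rhs g"
    and \<delta>1: "0 < \<delta>1" and f2: "UAS f2 \<delta>2 \<Delta>2" and \<delta>2: "0 < \<delta>2"
    and \<delta>: "0 < \<delta>" and \<Delta>: "\<Delta> \<le> \<Delta>2"
    and V: "C1_nonneg_time V" and V_nonneg: "\<And>t y. 0 \<le> t \<Longrightarrow> 0 \<le> V t y"
    and Kinf: "class_Kinf \<alpha>_lo" "class_Kinf \<alpha>_up" "class_Kinf \<alpha>"
    and c: "\<And>s. 0 \<le> s \<Longrightarrow> 0 < c s" "mono_on {0..} c"
    and V_lo: "\<And>t y. y \<in> annulus \<delta>1 \<Delta>1 \<Longrightarrow> 0 \<le> t \<Longrightarrow> \<alpha>_lo (norm_to_ball \<delta>1 y) \<le> V t y"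
    and V_up: "\<And>t y. y \<in> annulus \<delta>1 \<Delta>1 \<Longrightarrow> 0 \<le> t \<Longrightarrow> V t y \<le> \<alpha>_up (norm y)"
    and decrease: "\<And>t y. y \<in> annulus \<delta>1 \<Delta>1 \<Longrightarrow> 0 \<le> t \<Longrightarrow>
      partial_t V t y + partial_x V t y (f1 t y) \<le> - \<alpha> (norm y)"
    and gradient: "\<And>t y. y \<in> annulus \<delta>1 \<Delta>1 \<Longrightarrow> 0 \<le> t \<Longrightarrow> onorm (partial_x V t y) \<le> c (norm y)"
    and G: "mono_on {0..} G" "\<And>s. 0 \<le> s \<Longrightarrow> 0 \<le> G s"
    and g_bound: "\<And>t x. 0 \<le> t \<Longrightarrow> mat_norm (g t x) \<le> G (norm x)"
    and bounded: "\<And>t0 x0. 0 \<le> t0 \<Longrightarrow> norm x0 \<le> \<Delta> \<Longrightarrow>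
      solution_satisfies F t0 x0 (\<lambda>x. \<forall>t\<ge>t0. norm (x t) \<le> \<Delta>1)"
    and small: "\<delta>1 + inv_into {0..} \<alpha>_lo (\<alpha>_up \<delta>1) \<le> \<delta> / 2" "2 * \<delta>2 \<le> \<delta> / 2"
      "c \<Delta>1 * G \<Delta>1 * (2 * \<delta>2) \<le> \<alpha> \<delta>1 / 2"
    and \<Delta>1: "\<delta>1 < \<Delta>1"
  shows "UAS F \<delta> \<Delta>"
proof -
  \<comment> \<open>The rate of decrease of \<open>V\<close> that remains when the interconnection
    term consumes half of \<open>\<alpha> \<delta>1\<close>.\<close>
  define k where "k = \<alpha> \<delta>1 / 2"
  have k: "0 < k" using class_Kinf_pos[OF Kinf(3) \<delta>1] by (simp add: k_def)
  \<comment> \<open>How far beyond \<open>\<delta>1\<close> the first component can be while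
    \<open>V\<close> does not exceed \<open>\<alpha>_up \<delta>1\<close>.\<close>
  define w where "w = inv_into {0..} \<alpha>_lo (\<alpha>_up \<delta>1)"
  have w: "v \<le> w" if "0 \<le> v" "\<alpha>_lo v \<le> \<alpha>_up \<delta>1" for v
    unfolding w_def using Kinf(1) that class_Kinf_pos[OF Kinf(2) \<delta>1]
    by (intro le_inv_into_class_Kinf) auto
  have "0 \<le> w"
    by (rule w) (use class_Kinf_zero[OF Kinf(1)] class_Kinf_pos[OF Kinf(2) \<delta>1] in auto)

  obtain \<eta>2 \<sigma>2 where \<eta>2: "class_Kinf \<eta>2" and \<sigma>2: "class_L \<sigma>2"
    and US2: "\<And>x0 t0. norm x0 \<le> \<Delta>2 \<Longrightarrow> 0 \<le> t0 \<Longrightarrow>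
      solution_satisfies f2 t0 x0 (\<lambda>x. \<forall>t\<ge>t0. norm_to_ball \<delta>2 (x t) \<le> \<eta>2 (norm x0))"
    and UA2: "\<And>x0 t0. norm x0 \<le> \<Delta>2 \<Longrightarrow> 0 \<le> t0 \<Longrightarrow>
      solution_satisfies f2 t0 x0 (\<lambda>x. \<forall>t\<ge>t0. norm_to_ball \<delta>2 (x t) \<le> \<sigma>2 (t - t0))"
    using f2 unfolding UAS_def US_def UA_def by auto

  have solution:
    "norm (x t) \<le> \<Delta>1"
    "norm (snd (x t)) \<le> \<delta>2 + \<eta>2 (norm (snd x0))"
    "norm (snd (x t)) \<le> \<delta>2 + \<sigma>2 (t - t0)"
    if "0 \<le> t0" "norm x0 \<le> \<Delta>" "is_solution F t0 x0 x" "t0 \<le> t" for t0 x0 x t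
  proof -
    show "norm (x t) \<le> \<Delta>1"
      using bounded that by (auto simp: solution_satisfies_def)
    have "norm (snd x0) \<le> \<Delta>2" using that(2) \<Delta> norm_snd_le[of "snd x0" "fst x0"] by simp
    moreover have "is_solution f2 t0 (snd x0) (\<lambda>t. snd (x t))"
      \<comment> \<open>\<open>F\<close> carries no parameter, so the cascade is instantiated with
        functions that ignore theirs.\<close>
      using is_solution_cascade_snd[of "\<lambda>t y _. f1 t y" "\<lambda>t y _. f2 t y" "\<lambda>t x _. g t x" undefined]
        that(3) by (simp add: F_def cascade_def)
    ultimately have "norm_to_ball \<delta>2 (snd (x t)) \<le> \<eta>2 (norm (snd x0))"
      "norm_to_ball \<delta>2 (snd (x t)) \<le> \<sigma>2 (t - t0)"
      using US2[of "snd x0" t0] UA2[of "snd x0" t0] that(1,4)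
      unfolding solution_satisfies_def by blast+
    with norm_le_norm_to_ball[of \<delta>2 "snd (x t)"] \<delta>2
    show "norm (snd (x t)) \<le> \<delta>2 + \<eta>2 (norm (snd x0))"
      "norm (snd (x t)) \<le> \<delta>2 + \<sigma>2 (t - t0)" by auto
  qed

  have in_annulus: "fst (x t) \<in> annulus \<delta>1 \<Delta>1"
    if "0 \<le> t0" "norm x0 \<le> \<Delta>" "is_solution F t0 x0 x" "t0 \<le> t" "\<delta>1 \<le> norm (fst (x t))" for t0 x0 x t
    using solution(1)[OF that(1-4)] norm_fst_le[of "fst (x t)" "snd (x t)"] that(5)
    by (simp add: annulus_def)

  have V_deriv: "\<exists>D \<le> - k. ((\<lambda>s. V s (fst (x s))) has_real_derivative D) (at_right t)"
    if x: "0 \<le> t0" "norm x0 \<le> \<Delta>" "is_solution F t0 x0 x" "t0 \<le> t"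
      and outside: "\<delta>1 \<le> norm (fst (x t))" and x2: "norm (snd (x t)) \<le> 2 * \<delta>2" for t0 x0 x t
  proof -
    have ann: "fst (x t) \<in> annulus \<delta>1 \<Delta>1" using in_annulus x outside .
    then have le: "norm (fst (x t)) \<le> \<Delta>1" by (simp add: annulus_def)
    have int: "((\<lambda>s. f1 s (fst (x s)) + g s (x s) *v snd (x s)) has_integral (fst (x r) - fst (x t0))) {t0..r}"
      if "t0 \<le> r" for r
    proof -
      have "((\<lambda>s. F s (x s)) has_integral (x r - x t0)) {t0..r}"
        using x(3) that unfolding is_solution_def by blast
      from has_integral_linear[OF this bounded_linear_fst] show ?thesis
        by (simp add: F_def o_def)
    qed
    \<comment> \<open>Monotonicity of \<open>\<alpha>\<close>, \<open>c\<close> and \<open>G\<close>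
      replaces the bounds at the current state by constants: \<open>\<alpha>\<close> is smallest at
      radius \<open>\<delta>1\<close>, \<open>c\<close> and \<open>G\<close> are largest at
      \<open>\<Delta>1\<close>.\<close>
    have "\<exists>D \<le> - \<alpha> \<delta>1 + c \<Delta>1 * G \<Delta>1 * norm (snd (x t)).
        ((\<lambda>s. V s (fst (x s))) has_real_derivative D) (at_right t)"
    proof (rule lyapunov_right_derivative[OF V f1 g x(1,4) _ int])
      show "continuous_on {t0..} x" using x(3) by (simp add: is_solution_def)
      show "partial_t V s (fst (x t)) + partial_x V s (fst (x t)) (f1 s (fst (x t))) \<le> - \<alpha> \<delta>1"
        if "0 \<le> s" for s
        using decrease[OF ann that] class_Kinf_mono[OF Kinf(3), of \<delta>1 "norm (fst (x t))"] outside \<delta>1 by simp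
      have "c (norm (fst (x t))) \<le> c \<Delta>1"
        using c(2) le \<delta>1 \<Delta>1 by (auto intro: mono_onD)
      then show "onorm (partial_x V t (fst (x t))) \<le> c \<Delta>1"
        using gradient[OF ann, of t] x by simp
      show "0 \<le> c \<Delta>1" using c(1)[of \<Delta>1] \<delta>1 \<Delta>1 by simp
      have "G (norm (x t)) \<le> G \<Delta>1"
        using G(1) solution(1)[OF x] \<delta>1 \<Delta>1 by (auto intro: mono_onD)
      then show "mat_norm (g s (x t)) \<le> G \<Delta>1" if "0 \<le> s" for s
        using g_bound[OF that, of "x t"] by simp
    qed
    moreover have "c \<Delta>1 * G \<Delta>1 * norm (snd (x t)) \<le> c \<Delta>1 * G \<Delta>1 * (2 * \<delta>2)"
      using x2 c(1)[of \<Delta>1] G(2)[of \<Delta>1] \<delta>1 \<Delta>1 by (intro mult_left_mono) auto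
    ultimately show ?thesis
      using small(3) unfolding k_def by (elim exE conjE, intro exI conjI) (auto elim: order_trans)
  qed

  have V_cont: "continuous_on {s..t} (\<lambda>s. V s (fst (x s)))" and x_cont: "continuous_on {s..t} (\<lambda>s. fst (x s))"
    if "0 \<le> t0" "is_solution F t0 x0 x" "t0 \<le> s" for t0 x0 x s t
  proof -
    have x: "continuous_on {s..t} x"
      by (rule continuous_on_subset[of "{t0..}"]) (use that in \<open>auto simp: is_solution_def\<close>)
    then show "continuous_on {s..t} (\<lambda>s. fst (x s))" by (rule continuous_on_fst)
    have "continuous_on ({0..} \<times> UNIV) (\<lambda>(s, y). V s y)"
    proof -
      obtain V' where V': "\<And>p. p \<in> {0..} \<times> UNIV \<Longrightarrow>
          ((\<lambda>(s, y). V s y) has_derivative blinfun_apply (V' p)) (at p within {0..} \<times> UNIV)"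
        using V unfolding C1_nonneg_time_def by blast
      then show ?thesis by (rule has_derivative_continuous_on)
    qed
    moreover have "continuous_on {s..t} (\<lambda>s. (s, fst (x s)))"
      by (intro continuous_on_Pair continuous_on_id continuous_on_fst x)
    moreover have "(\<lambda>s. (s, fst (x s))) ` {s..t} \<subseteq> {0..} \<times> UNIV" using that by auto
    ultimately have "continuous_on {s..t} (\<lambda>r. (\<lambda>(s, y). V s y) (r, fst (x r)))"
      by (rule continuous_on_compose2)
    then show "continuous_on {s..t} (\<lambda>s. V s (fst (x s)))" by simp
  qed

  \<comment> \<open>Once the first component is within \<open>\<delta>1\<close> and the second stays
    within \<open>2 * \<delta>2\<close>, each component is confined to radius
    \<open>\<delta> / 2\<close>, so the triangle inequality keeps the state in the target
    ball.\<close>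
  have trap: "norm_to_ball \<delta> (x t) = 0"
    if x: "0 \<le> t0" "norm x0 \<le> \<Delta>" "is_solution F t0 x0 x" and s: "t0 \<le> s" "s \<le> t"
      and start: "norm (fst (x s)) \<le> \<delta>1" and x2: "\<And>r. s \<le> r \<Longrightarrow> norm (snd (x r)) \<le> 2 * \<delta>2"
    for t0 x0 x s t
  proof -
    have "norm (fst (x t)) \<le> \<delta> / 2"
    proof (cases "norm (fst (x t)) \<le> \<delta>1")
      case True
      then show ?thesis using small(1) \<open>0 \<le> w\<close> by (simp add: w_def)
    next
      case False
      have "V t (fst (x t)) \<le> \<alpha>_up \<delta>1"
      proof (rule lyapunov_trap[OF s(2) x_cont[OF x(1,3) s(1)] V_cont[OF x(1,3) s(1)] start])
        fix r assume r: "s \<le> r"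
        show "\<exists>D \<le> 0. ((\<lambda>s. V s (fst (x s))) has_real_derivative D) (at_right r)"
          if "\<delta>1 \<le> norm (fst (x r))"
        proof -
          have "t0 \<le> r" using r s by simp
          from V_deriv[OF x this that x2[OF r]] obtain D
            where "D \<le> - k" "((\<lambda>s. V s (fst (x s))) has_real_derivative D) (at_right r)" by blast
          with k show ?thesis by (intro exI[of _ D]) simp
        qed
        show "V r (fst (x r)) \<le> \<alpha>_up \<delta>1" if "norm (fst (x r)) = \<delta>1"
          using V_up[of "fst (x r)" r] that r s x(1) \<Delta>1 by (simp add: annulus_def)
      qed (use False in simp)
      moreover have "\<alpha>_lo (norm_to_ball \<delta>1 (fst (x t))) \<le> V t (fst (x t))"
        using in_annulus[OF x, of t] False s x(1) by (intro V_lo) auto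
      moreover have "0 \<le> norm_to_ball \<delta>1 (fst (x t))"
        using norm_le_norm_to_ball[of \<delta>1 "fst (x t)"] False \<delta>1 by simp
      ultimately have "norm_to_ball \<delta>1 (fst (x t)) \<le> w" by (intro w) auto
      then show ?thesis
        using norm_le_norm_to_ball[of \<delta>1 "fst (x t)"] small(1) \<delta>1 by (simp add: w_def)
    qed
    moreover have "norm (snd (x t)) \<le> \<delta> / 2" using x2[OF s(2)] small(2) by simp
    ultimately have "norm (x t) \<le> \<delta>"
      using norm_Pair_le[of "fst (x t)" "snd (x t)"] by simp
    then show ?thesis by (rule norm_to_ball_eq_0)
  qed

  have existence: "\<exists>x. is_solution F t0 x0 x" if "0 \<le> t0" "norm x0 \<le> \<Delta>" for t0 x0
    using bounded[OF that] by (simp add: solution_satisfies_def)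
  have ball_bound: "norm_to_ball \<delta> (x t) \<le> \<Delta>1"
    if "0 \<le> t0" "norm x0 \<le> \<Delta>" "is_solution F t0 x0 x" "t0 \<le> t" for t0 x0 x t
    using norm_to_ball_le_norm[of \<delta> "x t"] solution(1)[OF that] \<delta> by simp

  have "US F \<delta> \<Delta>"
  proof -
    have "(\<eta>2 \<longlongrightarrow> \<eta>2 0) (at 0 within {0..})"
      using \<eta>2 unfolding class_Kinf_def class_K_def continuous_on_def
      by (metis atLeast_iff order_refl)
    then have "(\<eta>2 \<longlongrightarrow> \<eta>2 0) (at_right 0)"
      by (rule tendsto_within_subset) auto
    then have "\<forall>\<^sub>F r in at_right 0. \<eta>2 r < \<delta>2"
      by (rule order_tendstoD) (use class_Kinf_zero[OF \<eta>2] \<delta>2 in simp)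
    \<comment> \<open>A radius of initial states for which \<open>trap\<close> applies from the
      initial time on: \<open>\<eta>2 r < \<delta>2\<close> keeps the second component within
      \<open>2 * \<delta>2\<close>, and \<open>r < \<delta>1\<close> places the first one.\<close>
    then have "\<forall>\<^sub>F r in at_right 0. \<eta>2 r < \<delta>2 \<and> r \<in> {0<..<\<delta>1}"
      using eventually_at_right_real[OF \<delta>1] by (rule eventually_conj)
    then obtain r where r: "\<eta>2 r < \<delta>2" "0 < r" "r < \<delta>1"
      using eventually_happens'[OF trivial_limit_at_right_real] by fastforce
    \<comment> \<open>Initial states within \<open>r\<close> never leave the target ball; for all
      others the slope makes \<open>\<eta>\<close> at least \<open>\<Delta>1\<close>, which bounds
      the solution anyway.\<close>
    define \<eta> where "\<eta> s = \<Delta>1 / r * s" for s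
    have pos: "0 < \<Delta>1 / r" using r \<delta>1 \<Delta>1 by simp
    have "class_Kinf \<eta>"
      unfolding class_Kinf_def class_K_def
    proof (intro conjI)
      show "continuous_on {0..} \<eta>" unfolding \<eta>_def by (intro continuous_intros)
      show "strict_mono_on {0..} \<eta>"
        unfolding \<eta>_def by (rule strict_mono_onI) (rule mult_strict_left_mono[OF _ pos])
      show "\<eta> 0 = 0" by (simp add: \<eta>_def)
      show "filterlim \<eta> at_top at_top"
        unfolding \<eta>_def
        by (rule filterlim_tendsto_pos_mult_at_top[OF tendsto_const pos filterlim_ident])
    qed
    moreover have "norm_to_ball \<delta> (x t) \<le> \<eta> (norm x0)"
      if x: "0 \<le> t0" "norm x0 \<le> \<Delta>" "is_solution F t0 x0 x" "t0 \<le> t" for t0 x0 x t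
    proof (cases "norm x0 \<le> r")
      case True
      have "norm_to_ball \<delta> (x t) = 0"
      proof (rule trap[OF x(1-3) order_refl x(4)])
        have x0: "x t0 = x0" using x by (simp add: is_solution_def)
        show "norm (fst (x t0)) \<le> \<delta>1"
          unfolding x0 using norm_fst_le[of "fst x0" "snd x0"] True r by simp
        have "\<eta>2 (norm (snd x0)) \<le> \<eta>2 r"
          by (rule class_Kinf_mono[OF \<eta>2 norm_ge_zero])
            (use norm_snd_le[of "snd x0" "fst x0"] True in simp)
        then show "norm (snd (x s)) \<le> 2 * \<delta>2" if "t0 \<le> s" for s
          using solution(2)[OF x(1-3) that] r by simp
      qed
      then show ?thesis using mult_nonneg_nonneg[OF less_imp_le[OF pos] norm_ge_zero]
        by (simp add: \<eta>_def)
    next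
      case False
      then have "\<Delta>1 / r * r \<le> \<Delta>1 / r * norm x0"
        using pos by (intro mult_left_mono) auto
      then show ?thesis using ball_bound[OF x] r by (simp add: \<eta>_def)
    qed
    ultimately show ?thesis
      unfolding US_def solution_satisfies_def using existence by (intro exI[of _ \<eta>]) auto
  qed
  moreover have "UA F \<delta> \<Delta>"
  proof -
    \<comment> \<open>After time \<open>T\<close> the second component is within
      \<open>2 * \<delta>2\<close>, uniformly in the initial data.\<close>
    have "\<forall>\<^sub>F s in at_top. \<sigma>2 s < \<delta>2"
      by (rule order_tendstoD[where y=0]) (use \<sigma>2 \<delta>2 in \<open>auto simp: class_L_def\<close>)
    then have "\<forall>\<^sub>F s in at_top. \<sigma>2 s < \<delta>2 \<and> 0 \<le> s"
      using eventually_ge_at_top by (rule eventually_conj)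
    then obtain T where T: "\<sigma>2 T < \<delta>2" "0 \<le> T"
      using eventually_happens'[OF trivial_limit_at_top_linorder] by fastforce
    \<comment> \<open>At time \<open>T\<close> outside the small ball, \<open>V\<close> is at most
      \<open>\<alpha>_up \<Delta>1\<close>. Decreasing at rate \<open>k\<close> until
      \<open>T'\<close> would cost one unit more than that and make \<open>V\<close> negative, so
      the first component must enter the ball in between.\<close>
    define T' where "T' = T + (\<alpha>_up \<Delta>1 + 1) / k"
    have "0 \<le> \<alpha>_up \<Delta>1" using class_Kinf_pos[OF Kinf(2), of \<Delta>1] \<delta>1 \<Delta>1 by simp
    then have T': "T \<le> T'" "k * (T' - T) = \<alpha>_up \<Delta>1 + 1"
      using k by (auto simp: T'_def field_simps)
    have after: "norm_to_ball \<delta> (x t) = 0"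
      if x: "0 \<le> t0" "norm x0 \<le> \<Delta>" "is_solution F t0 x0 x" and t: "t0 + T' \<le> t" for t0 x0 x t
    proof -
      have x2: "norm (snd (x s)) \<le> 2 * \<delta>2" if "t0 + T \<le> s" for s
      proof -
        have "\<sigma>2 (s - t0) \<le> \<sigma>2 T"
          using \<sigma>2 that T by (auto simp: class_L_def monotone_on_def)
        then show ?thesis using solution(3)[OF x, of s] T that by simp
      qed
      have "\<exists>s\<in>{t0 + T..t0 + T'}. norm (fst (x s)) \<le> \<delta>1"
      proof (rule ccontr)
        assume "\<not> ?thesis"
        then have outside: "\<delta>1 < norm (fst (x s))" if "t0 + T \<le> s" "s \<le> t0 + T'" for s
          using that by (auto simp: not_le)
        have "V (t0 + T') (fst (x (t0 + T')))
            \<le> V (t0 + T) (fst (x (t0 + T))) - k * (t0 + T' - (t0 + T))"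
        proof (rule right_derivative_decrease)
          show "continuous_on {t0 + T..t0 + T'} (\<lambda>s. V s (fst (x s)))"
            by (rule V_cont[OF x(1,3)]) (use T in simp)
          fix s assume s: "t0 + T \<le> s" "s < t0 + T'"
          then show "\<exists>D \<le> - k. ((\<lambda>s. V s (fst (x s))) has_real_derivative D) (at_right s)"
            using V_deriv[OF x, of s] outside[of s] x2[of s] T by simp
        qed (use T' in simp)
        moreover have "V (t0 + T) (fst (x (t0 + T))) \<le> \<alpha>_up \<Delta>1"
        proof -
          have ann: "fst (x (t0 + T)) \<in> annulus \<delta>1 \<Delta>1"
            using in_annulus[OF x, of "t0 + T"] outside[of "t0 + T"] T T' by simp
          then have "\<alpha>_up (norm (fst (x (t0 + T)))) \<le> \<alpha>_up \<Delta>1"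
            unfolding annulus_def by (intro class_Kinf_mono[OF Kinf(2) norm_ge_zero]) simp
          then show ?thesis using V_up[OF ann, of "t0 + T"] x(1) T by simp
        qed
        ultimately show False
          using V_nonneg[of "t0 + T'" "fst (x (t0 + T'))"] T T' x(1) by simp
      qed
      then obtain s where s: "t0 + T \<le> s" "s \<le> t0 + T'" "norm (fst (x s)) \<le> \<delta>1" by auto
      show ?thesis
        by (rule trap[OF x _ _ s(3) x2]) (use s T t in auto)
    qed
    \<comment> \<open>Equal to \<open>\<Delta>1\<close> up to \<open>T'\<close>, then a linear
      descent to 0 over one unit of time, which makes the bound continuous.\<close>
    define \<sigma> where "\<sigma> s = \<Delta>1 * max 0 (min 1 (T' + 1 - s))" for s
    have "class_L \<sigma>"
      unfolding class_L_def
    proof (intro conjI allI impI)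
      show "continuous_on {0..} \<sigma>" unfolding \<sigma>_def by (intro continuous_intros)
      show "0 \<le> \<sigma> s" for s using \<delta>1 \<Delta>1 by (simp add: \<sigma>_def)
      show "antimono_on {0..} \<sigma>"
        using \<delta>1 \<Delta>1 unfolding \<sigma>_def by (intro monotone_onI mult_left_mono) auto
      have "\<forall>\<^sub>F s in at_top. \<sigma> s = 0"
        using eventually_ge_at_top[of "T' + 1"] by eventually_elim (simp add: \<sigma>_def)
      then show "(\<sigma> \<longlongrightarrow> 0) at_top" by (rule tendsto_eventually)
    qed
    moreover have "norm_to_ball \<delta> (x t) \<le> \<sigma> (t - t0)"
      if x: "0 \<le> t0" "norm x0 \<le> \<Delta>" "is_solution F t0 x0 x" "t0 \<le> t" for t0 x0 x t
    proof (cases "t0 + T' \<le> t")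
      case True
      then show ?thesis using after[OF x(1-3)] \<delta>1 \<Delta>1 by (simp add: \<sigma>_def)
    next
      case False
      then have "\<sigma> (t - t0) = \<Delta>1" by (simp add: \<sigma>_def)
      then show ?thesis using ball_bound[OF x] by simp
    qed
    ultimately show ?thesis
      unfolding UA_def solution_satisfies_def using existence by (intro exI[of _ \<sigma>]) auto
  qed
  ultimately show ?thesis unfolding UAS_def ..
qed

section \<open>Choice of the radii and parameters\<close>

theorem theorem1:
  fixes f1 :: "real \<Rightarrow> real^'n1 \<Rightarrow> real^'m1 \<Rightarrow> real^'n1"
    and f2 :: "real \<Rightarrow> real^'n2 \<Rightarrow> real^'m2 \<Rightarrow> real^'n2"
    and g :: "real \<Rightarrow> (real^'n1) \<times> (real^'n2) \<Rightarrow> (real^'m1) \<times> (real^'m2) \<Rightarrow> real^'n2^'n1"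
    and \<Theta>1 :: "(real^'m1) set" and \<Theta>2 :: "(real^'m2) set"
    and \<theta>1s :: "real \<Rightarrow> real \<Rightarrow> real^'m1"
    and V1 :: "real \<Rightarrow> real \<Rightarrow> real \<Rightarrow> real^'n1 \<Rightarrow> real"
    and \<alpha>_lo \<alpha>_up \<alpha> c :: "real \<Rightarrow> real \<Rightarrow> real \<Rightarrow> real"
    and G :: "real \<Rightarrow> real"
    and \<Delta>0 :: real
    and \<gamma> :: "real \<Rightarrow> real \<Rightarrow> real \<Rightarrow> real \<Rightarrow> real \<times> real \<Rightarrow> real"
  assumes reg_f1: "\<And>\<theta>1. regular_rhs (\<lambda>t x1. f1 t x1 \<theta>1)"
    and reg_f2: "\<And>\<theta>2. regular_rhs (\<lambda>t x2. f2 t x2 \<theta>2)"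
    and reg_g: "\<And>\<theta>. regular_rhs (\<lambda>t x. g t x \<theta>)"
    and A1: "USPAS f2 \<Theta>2"
    and A2_param: "\<And>\<delta>1 \<Delta>1. 0 < \<delta>1 \<Longrightarrow> \<delta>1 < \<Delta>1 \<Longrightarrow> \<theta>1s \<delta>1 \<Delta>1 \<in> \<Theta>1"
    and A2_V1: "\<And>\<delta>1 \<Delta>1. 0 < \<delta>1 \<Longrightarrow> \<delta>1 < \<Delta>1 \<Longrightarrow>
        C1_nonneg_time (V1 \<delta>1 \<Delta>1) \<and> (\<forall>t\<ge>0. \<forall>x1. 0 \<le> V1 \<delta>1 \<Delta>1 t x1)"
    and A2_Kinf: "\<And>\<delta>1 \<Delta>1. 0 < \<delta>1 \<Longrightarrow> \<delta>1 < \<Delta>1 \<Longrightarrow>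
        class_Kinf (\<alpha>_lo \<delta>1 \<Delta>1) \<and> class_Kinf (\<alpha>_up \<delta>1 \<Delta>1) \<and> class_Kinf (\<alpha> \<delta>1 \<Delta>1)"
    and A2_c: "\<And>\<delta>1 \<Delta>1. 0 < \<delta>1 \<Longrightarrow> \<delta>1 < \<Delta>1 \<Longrightarrow>
        continuous_on {0..} (c \<delta>1 \<Delta>1) \<and> (\<forall>s\<ge>0. 0 < c \<delta>1 \<Delta>1 s) \<and> mono_on {0..} (c \<delta>1 \<Delta>1)"
    and A2_bounds: "\<And>\<delta>1 \<Delta>1 x1 t. 0 < \<delta>1 \<Longrightarrow> \<delta>1 < \<Delta>1 \<Longrightarrow> x1 \<in> annulus \<delta>1 \<Delta>1 \<Longrightarrow> 0 \<le> t \<Longrightarrow>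
        \<alpha>_lo \<delta>1 \<Delta>1 (norm_to_ball \<delta>1 x1) \<le> V1 \<delta>1 \<Delta>1 t x1
        \<and> V1 \<delta>1 \<Delta>1 t x1 \<le> \<alpha>_up \<delta>1 \<Delta>1 (norm x1)"
    and A2_decrease: "\<And>\<delta>1 \<Delta>1 x1 t. 0 < \<delta>1 \<Longrightarrow> \<delta>1 < \<Delta>1 \<Longrightarrow> x1 \<in> annulus \<delta>1 \<Delta>1 \<Longrightarrow> 0 \<le> t \<Longrightarrow>
        partial_t (V1 \<delta>1 \<Delta>1) t x1 + partial_x (V1 \<delta>1 \<Delta>1) t x1 (f1 t x1 (\<theta>1s \<delta>1 \<Delta>1))
          \<le> - \<alpha> \<delta>1 \<Delta>1 (norm x1)"
    and A2_gradient: "\<And>\<delta>1 \<Delta>1 x1 t. 0 < \<delta>1 \<Longrightarrow> \<delta>1 < \<Delta>1 \<Longrightarrow> x1 \<in> annulus \<delta>1 \<Delta>1 \<Longrightarrow> 0 \<le> t \<Longrightarrow>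
        onorm (partial_x (V1 \<delta>1 \<Delta>1) t x1) \<le> c \<delta>1 \<Delta>1 (norm x1)"
    and A2_limit: "\<And>\<Delta>1. 0 < \<Delta>1 \<Longrightarrow>
        ((\<lambda>\<delta>1. inv_into {0..} (\<alpha>_lo \<delta>1 \<Delta>1) (\<alpha>_up \<delta>1 \<Delta>1 \<delta>1)) \<longlongrightarrow> 0) (at_right 0)"
    and A3_G: "mono_on {0..} G" "\<And>s. 0 \<le> s \<Longrightarrow> 0 \<le> G s"
    and A3_bound: "\<And>x \<theta> t. \<theta> \<in> \<Theta>1 \<times> \<Theta>2 \<Longrightarrow> 0 \<le> t \<Longrightarrow> mat_norm (g t x \<theta>) \<le> G (norm x)"
    and A4_\<Delta>0: "0 < \<Delta>0"
    and A4_\<gamma>: "\<And>\<delta>1 \<Delta>1 \<delta>2 \<Delta>2. 0 < \<delta>1 \<Longrightarrow> max \<delta>1 \<Delta>0 < \<Delta>1 \<Longrightarrow> 0 < \<delta>2 \<Longrightarrow> \<delta>2 < \<Delta>2 \<Longrightarrow>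
        continuous_on ({0<..} \<times> {0<..}) (\<gamma> \<delta>1 \<Delta>1 \<delta>2 \<Delta>2)
        \<and> (\<forall>r\<in>{0<..} \<times> {0<..}. 0 \<le> \<gamma> \<delta>1 \<Delta>1 \<delta>2 \<Delta>2 r)"
    and A4_trajectories: "\<And>\<delta>1 \<Delta>1 \<delta>2 \<Delta>2. 0 < \<delta>1 \<Longrightarrow> max \<delta>1 \<Delta>0 < \<Delta>1 \<Longrightarrow> 0 < \<delta>2 \<Longrightarrow> \<delta>2 < \<Delta>2 \<Longrightarrow>
        \<exists>\<theta>2\<in>D_set f2 \<delta>2 \<Delta>2 \<inter> \<Theta>2. \<forall>t0\<ge>0. \<forall>x0.
          norm x0 \<le> \<gamma> \<delta>1 \<Delta>1 \<delta>2 \<Delta>2 (\<Delta>1, \<Delta>2) \<longrightarrow>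
          solution_satisfies (\<lambda>t x. cascade f1 f2 g t x (\<theta>1s \<delta>1 \<Delta>1, \<theta>2)) t0 x0
            (\<lambda>x. \<forall>t\<ge>t0. norm (x t) \<le> \<Delta>1)"
    (* gamma may depend on delta1, delta2; its limit is uniform for these in bounded sets *)
    and A4_limit: "\<And>d M. 0 < d \<Longrightarrow>
        \<forall>\<^sub>F (\<Delta>1, \<Delta>2) in at_top \<times>\<^sub>F at_top. \<forall>\<delta>1\<in>{0<..d}. \<forall>\<delta>2\<in>{0<..d}.
          M \<le> \<gamma> \<delta>1 \<Delta>1 \<delta>2 \<Delta>2 (\<Delta>1, \<Delta>2)"
  shows "USPAS (cascade f1 f2 g) (\<Theta>1 \<times> \<Theta>2)"
  unfolding USPAS_def
proof (intro allI impI)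
  fix \<delta> \<Delta> :: real assume "0 < \<delta> \<and> \<delta> < \<Delta>"
  then have \<delta>: "0 < \<delta>" "\<delta> < \<Delta>" by auto
  \<comment> \<open>The thresholds hold for all \<open>\<delta>1\<close> and
    \<open>\<delta>2\<close> up to \<open>\<delta>\<close> at once. This avoids circularity: the
    outer radii are fixed first although \<open>\<gamma>\<close> depends on inner radii chosen
    later.\<close>
  obtain P Q where P: "eventually P at_top" and Q: "eventually Q at_top"
    and PQ: "\<And>\<Delta>1 \<Delta>2 \<delta>1 \<delta>2. P \<Delta>1 \<Longrightarrow> Q \<Delta>2 \<Longrightarrow> \<delta>1 \<in> {0<..\<delta>} \<Longrightarrow> \<delta>2 \<in> {0<..\<delta>} \<Longrightarrow>
      \<Delta> \<le> \<gamma> \<delta>1 \<Delta>1 \<delta>2 \<Delta>2 (\<Delta>1, \<Delta>2)"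
    using A4_limit[OF \<delta>(1), of \<Delta>] unfolding eventually_prod_filter by auto
  obtain \<Delta>1 where \<Delta>1: "P \<Delta>1" "max \<delta> \<Delta>0 < \<Delta>1"
    using eventually_happens'[OF trivial_limit_at_top_linorder
        eventually_conj[OF P eventually_gt_at_top[of "max \<delta> \<Delta>0"]]] by blast
  obtain \<Delta>2 where \<Delta>2: "Q \<Delta>2" "\<Delta> < \<Delta>2"
    using eventually_happens'[OF trivial_limit_at_top_linorder
        eventually_conj[OF Q eventually_gt_at_top[of \<Delta>]]] by blast
  have "0 < \<Delta>1" using \<Delta>1 A4_\<Delta>0 by simp
  \<comment> \<open>Two quarters of \<open>\<delta>\<close>, one for \<open>\<delta>1\<close> and
    one for the inverse term, give the half allowed to the first component. The limit is taken at
    fixed \<open>\<Delta>1\<close>, which is why \<open>\<Delta>1\<close> comes before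
    \<open>\<delta>1\<close>.\<close>
  have "\<forall>\<^sub>F d in at_right 0. inv_into {0..} (\<alpha>_lo d \<Delta>1) (\<alpha>_up d \<Delta>1 d) < \<delta> / 4"
    by (rule order_tendstoD(2)[OF A2_limit[OF \<open>0 < \<Delta>1\<close>]]) (use \<delta> in simp)
  moreover have "\<forall>\<^sub>F d in at_right 0. d \<in> {0<..<\<delta> / 4}"
    by (rule eventually_at_right_real) (use \<delta> in simp)
  ultimately have "\<forall>\<^sub>F d in at_right 0.
      inv_into {0..} (\<alpha>_lo d \<Delta>1) (\<alpha>_up d \<Delta>1 d) < \<delta> / 4 \<and> d \<in> {0<..<\<delta> / 4}"
    by (rule eventually_conj)
  then obtain \<delta>1 where \<delta>1: "inv_into {0..} (\<alpha>_lo \<delta>1 \<Delta>1) (\<alpha>_up \<delta>1 \<Delta>1 \<delta>1) < \<delta> / 4" "0 < \<delta>1" "\<delta>1 < \<delta> / 4"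
    using eventually_happens'[OF trivial_limit_at_right_real] by fastforce
  have lt: "\<delta>1 < \<Delta>1" using \<delta>1 \<Delta>1 \<delta> by simp
  have c_pos: "0 < c \<delta>1 \<Delta>1 s" if "0 \<le> s" for s
    using A2_c[OF \<delta>1(2) lt] that by blast
  have V1_nonneg: "0 \<le> V1 \<delta>1 \<Delta>1 t y" if "0 \<le> t" for t y
    using A2_V1[OF \<delta>1(2) lt] that by blast
  have Kinf: "class_Kinf (\<alpha>_lo \<delta>1 \<Delta>1)" "class_Kinf (\<alpha>_up \<delta>1 \<Delta>1)" "class_Kinf (\<alpha> \<delta>1 \<Delta>1)"
    using A2_Kinf[OF \<delta>1(2) lt] by blast+
  define K where "K = c \<delta>1 \<Delta>1 \<Delta>1 * G \<Delta>1"
  have K: "0 \<le> K"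
    unfolding K_def using c_pos[of \<Delta>1] A3_G(2)[of \<Delta>1] \<open>0 < \<Delta>1\<close> by simp
  have \<alpha>: "0 < \<alpha> \<delta>1 \<Delta>1 \<delta>1"
    by (rule class_Kinf_pos[OF Kinf(3) \<delta>1(2)])
  \<comment> \<open>The first entry gives \<open>2 * \<delta>2 \<le> \<delta> / 2\<close>, the
    second bounds the interconnection by half of
    \<open>\<alpha> \<delta>1 \<Delta>1 \<delta>1\<close>. The divisor has \<open>K + 1\<close>
    because \<open>K\<close> may be 0.\<close>
  define \<delta>2 where "\<delta>2 = min (\<delta> / 4) (\<alpha> \<delta>1 \<Delta>1 \<delta>1 / (4 * (K + 1)))"
  have \<delta>2: "0 < \<delta>2" "\<delta>2 \<le> \<delta> / 4"
    using \<delta> \<alpha> K min.cobounded1[of "\<delta> / 4"] unfolding \<delta>2_def by auto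
  have "(K + 1) * \<delta>2 \<le> (K + 1) * (\<alpha> \<delta>1 \<Delta>1 \<delta>1 / (4 * (K + 1)))"
    using K by (intro mult_left_mono) (auto simp: \<delta>2_def)
  also have "\<dots> = \<alpha> \<delta>1 \<Delta>1 \<delta>1 / 4" using K by (simp add: field_simps)
  finally have K\<delta>2: "K * (2 * \<delta>2) \<le> \<alpha> \<delta>1 \<Delta>1 \<delta>1 / 2"
    using \<delta>2 by (simp add: algebra_simps)
  have max: "max \<delta>1 \<Delta>0 < \<Delta>1" "\<delta>2 < \<Delta>2" using \<Delta>1 \<Delta>2 lt \<delta>2 \<delta> by auto
  \<comment> \<open>This parameter depends on all four radii and can be chosen only once they are
    fixed.\<close>
  obtain \<theta>2 where \<theta>2: "\<theta>2 \<in> D_set f2 \<delta>2 \<Delta>2" "\<theta>2 \<in> \<Theta>2"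
    and traj: "\<And>t0 x0. 0 \<le> t0 \<Longrightarrow> norm x0 \<le> \<gamma> \<delta>1 \<Delta>1 \<delta>2 \<Delta>2 (\<Delta>1, \<Delta>2) \<Longrightarrow>
      solution_satisfies (\<lambda>t x. cascade f1 f2 g t x (\<theta>1s \<delta>1 \<Delta>1, \<theta>2)) t0 x0
        (\<lambda>x. \<forall>t\<ge>t0. norm (x t) \<le> \<Delta>1)"
    using A4_trajectories[OF \<delta>1(2) max(1) \<delta>2(1) max(2)] by blast
  have \<gamma>: "\<Delta> \<le> \<gamma> \<delta>1 \<Delta>1 \<delta>2 \<Delta>2 (\<Delta>1, \<Delta>2)"
    using PQ \<Delta>1 \<Delta>2 \<delta>1 \<delta>2 \<delta> by simp
  define \<theta> where "\<theta> = (\<theta>1s \<delta>1 \<Delta>1, \<theta>2)"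
  have \<theta>: "\<theta> \<in> \<Theta>1 \<times> \<Theta>2" using \<theta>2 A2_param[OF \<delta>1(2) lt] by (simp add: \<theta>_def)
  have "UAS (\<lambda>t x. (f1 t (fst x) (\<theta>1s \<delta>1 \<Delta>1) + g t x \<theta> *v snd x, f2 t (snd x) \<theta>2)) \<delta> \<Delta>"
  proof (rule UAS_cascade[OF reg_f1 reg_g \<delta>1(2) _ \<delta>2(1) \<delta>(1) less_imp_le[OF \<Delta>2(2)]
        A2_V1[OF \<delta>1(2) lt, THEN conjunct1] V1_nonneg Kinf c_pos
        A2_c[OF \<delta>1(2) lt, THEN conjunct2, THEN conjunct2]
        A2_bounds[OF \<delta>1(2) lt, THEN conjunct1] A2_bounds[OF \<delta>1(2) lt, THEN conjunct2]
        A2_decrease[OF \<delta>1(2) lt] A2_gradient[OF \<delta>1(2) lt] A3_G A3_bound[OF \<theta>] _ _ _ _ lt])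
    show "UAS (\<lambda>t y. f2 t y \<theta>2) \<delta>2 \<Delta>2" using \<theta>2 by (simp add: D_set_def)
    show "solution_satisfies (\<lambda>t x. (f1 t (fst x) (\<theta>1s \<delta>1 \<Delta>1) + g t x \<theta> *v snd x, f2 t (snd x) \<theta>2)) t0 x0
        (\<lambda>x. \<forall>t\<ge>t0. norm (x t) \<le> \<Delta>1)" if "0 \<le> t0" "norm x0 \<le> \<Delta>" for t0 x0
      using traj[of t0 x0] that \<gamma> by (simp add: cascade_def \<theta>_def)
    show "c \<delta>1 \<Delta>1 \<Delta>1 * G \<Delta>1 * (2 * \<delta>2) \<le> \<alpha> \<delta>1 \<Delta>1 \<delta>1 / 2"
      using K\<delta>2 by (simp add: K_def)
  qed (use \<delta>1 \<delta>2 in auto)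
  then show "\<exists>\<theta>\<in>\<Theta>1 \<times> \<Theta>2. UAS (\<lambda>t x. cascade f1 f2 g t x \<theta>) \<delta> \<Delta>"
    using \<theta> by (intro bexI[of _ \<theta>]) (simp_all add: cascade_def \<theta>_def)
qed

end
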